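(* Let $S=\mathbb{K}[x_1,\ldots,x_n]$ be a polynomial ring over a field $\mathbb{K}$. Let $J$ be an ideal of $S$ minimally generated by $r$ monomials $u_j=\prod_{i\in[n]}x_i^{\alpha_{j,i}}$ ($j\in[r]$), such that every variable $x_1,\ldots,x_n$ divides some $u_j$ and no $u_j$ is a pure power of a variable. Let $I=(u_1,\ldots,u_r,x_1^{e_1},\ldots,x_n^{e_n})$ with $e_i>\max\{\alpha_{j,i}: j\in[r]\}$ for all $i\in[n]$, and let $\mathbf{u}=x_1^{b_1}\cdots x_n^{b_n}\in \mathrm{LCM}(I)$. Let $$A=\{i\in[n]: 0<b_i<e_i\},\qquad B=\{i\in[n]: b_i=e_i\},$$ and for $j\in[r]$ let $$u_j'=\prod_{i\in A}x_i^{\alpha_{j,i}},\qquad \mathbf{u}'=\prod_{i\in A}x_i^{b_i},\qquad \mathcal{U}'=\{u_j' : j\in[r]\}\ \text{(a multiset indexed by } [r]).$$ Then: (i) $\mathbf{u}'\in\mathrm{LCM}(\mathcal{U}')$; (ii) $I_{\mathbf{u}}=\mathcal{U}'_{\mathbf{u}'}\star\{X'\}$, where $X'=\{r+i: i\in B\}$; (iii) there exist a simplicial complex $\Delta$ on at most $r$ vertices and an isomorphism $\phi: G_I[I_{\mathbf{u}}]\to G_{\mathcal{U}'}[\Delta]$ of underlying (undirected) graphs such that $\phi(T)=([r]\setminus(T\setminus X'))\setminus V$ for every vertex $T$ of $G_I[I_{\mathbf{u}}]$, where $V=\{j\in[r]: u_j'\nmid\mathbf{u}'\}$; (iv) if $T_1,T_2$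 are vertices of $G_I[I_{\mathbf{u}}]$ such that $|T_2|=|T_1|+1$, then $|\phi(T_1)|=|\phi(T_2)|+1$; (v) if $T_1\subseteq T_2$ are vertices of $G_I[I_{\mathbf{u}}]$, then $\phi(T_2)\subseteq\phi(T_1)$.
   Context: Notation: $[q]=\{1,\ldots,q\}$. For a multiset $\mathcal{U}=\{m_1,\ldots,m_q\}$ of monomials and $T\subseteq[q]$, put $\mathbf{m}_T=\mathrm{lcm}(m_j: j\in T)$, with $\mathbf{m}_\varnothing=1$. $\mathrm{LCM}(\mathcal{U})=\{\mathbf{m}_T: T\subseteq[q]\}$, and for $\mathbf{u}\in\mathrm{LCM}(\mathcal{U})$, $\mathcal{U}_{\mathbf{u}}=\{T\subseteq[q]:\mathbf{m}_T=\mathbf{u}\}$. $G_{\mathcal{U}}$ is the directed graph with vertex set $2^{[q]}$ and an edge from $T$ to $T'$ whenever $T'\subseteq T$ and $|T|=|T'|+1$, each vertex $T$ being labeled by $\mathbf{m}_T$. For a set $W$ of vertices, $G_{\mathcal{U}}[W]$ denotes the induced subgraph on $W$; in particular $G_{\mathcal{U}'}[\Delta]$ is the induced subgraph on the faces of $\Delta$, which are subsets of $[r]$. For the ideal $I$, the generators are ordered as $u_1,\ldots,u_r,x_1^{e_1},\ldots,x_n^{e_n}$ and indexed by $[r+n]$ (the $j$-th generator is $u_j$ for $j\le r$ and $x_{j-r}^{e_{j-r}}$ for $j>r$); $\mathrm{LCM}(I)$, $I_{\mathbf{u}}$ and $G_I$ are $\mathrm{LCM}(\mathcal{U})$, $\mathcal{U}_{\mathbf{u}}$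 and $G_{\mathcal{U}}$ for $\mathcal{U}$ this ordered generating set. For families of sets $\mathcal{X},\mathcal{Y}$, $\mathcal{X}\star\mathcal{Y}=\{X\cup Y: X\in\mathcal{X},\,Y\in\mathcal{Y}\}$. A simplicial complex on a vertex set $W$ is a collection of subsets of $W$ (its faces) that contains $\{w\}$ for every $w\in W$ and is closed under taking subsets.
   Formalization: The set A is taken as {i in [n] : b_i < e_i}, allowing b_i = 0, instead of 0 < b_i < e_i; as printed, (ii) and (iii) fail, e.g. for n=2, r=1, u_1=x_1x_2, e=(2,2), u=1. When all b_i > 0 the two agree. *)

theory Defs
  imports
    "HOL-Library.Poly_Mapping"
    "HOL-Algebra.Ideal"
    "Graph_Theory.Digraph_Isomorphism"
begin

section \<open>Monomials and the polynomial ring\<close>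

text \<open>
  A monomial is its exponent vector: \<open>lookup m i\<close> is the exponent of \<open>x\<^sub>i\<close>, multiplication of
  monomials is \<open>+\<close>, the monomial 1 is \<open>0\<close>, and the pure power \<open>x\<^sub>i\<^sup>k\<close> is
  \<open>Poly_Mapping.single i k\<close>.
  The type of finitely supported functions from monomials to \<open>'k\<close> carries the convolution product
  and hence is the polynomial ring over \<open>'k\<close> in the variables \<open>x\<^sub>i\<close>, \<open>i :: nat\<close>.
\<close>

type_synonym monom = "nat \<Rightarrow>\<^sub>0 nat"

type_synonym 'k mpoly = "monom \<Rightarrow>\<^sub>0 'k"

definition mono_in :: "nat \<Rightarrow> monom \<Rightarrow> bool" where
  "mono_in n m \<longleftrightarrow> Poly_Mapping.keys m \<subseteq> {1..n}"

definition poly_ring :: "nat \<Rightarrow> ('k::field) mpoly ring" where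
  "poly_ring n = \<lparr>carrier = {p. \<forall>m\<in>Poly_Mapping.keys p. mono_in n m},
     monoid.mult = (*), one = 1, zero = 0, add = (+)\<rparr>"

definition mono_poly :: "monom \<Rightarrow> ('k::field) mpoly" where
  "mono_poly m = Poly_Mapping.single m 1"

definition mono_dvd :: "monom \<Rightarrow> monom \<Rightarrow> bool"  (infix \<open>mdvd\<close> 50) where
  "m mdvd m' \<longleftrightarrow> (\<exists>k. m' = m + k)"

text \<open>Only meant for finite \<open>M\<close>; the inserted \<open>0\<close> gives \<open>mono_lcm {} = 0\<close>, the monomial 1.\<close>

definition mono_lcm :: "monom set \<Rightarrow> monom" where
  "mono_lcm M = Abs_poly_mapping (\<lambda>i. Max (insert 0 ((\<lambda>m. Poly_Mapping.lookup m i) ` M)))"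

text \<open>\<open>mono_restrict A m\<close> is the product of the factors \<open>x\<^sub>i\<^sup>a\<close> of \<open>m\<close> with \<open>i \<in> A\<close>.\<close>

definition mono_restrict :: "nat set \<Rightarrow> monom \<Rightarrow> monom" where
  "mono_restrict A m = (\<Sum>i\<in>A. Poly_Mapping.single i (Poly_Mapping.lookup m i))"

text \<open>
  The family \<open>u\<close> indexed by \<open>{1..r}\<close>; quantifying over proper sets of indices (rather than of
  elements) also makes the family irredundant, so its members are distinct.
\<close>

definition minimally_generated_by :: "nat \<Rightarrow> ('k::field) mpoly set \<Rightarrow> nat \<Rightarrow> (nat \<Rightarrow> monom) \<Rightarrow> bool"
  where
  "minimally_generated_by n J r u \<longleftrightarrow>
     (\<forall>j\<in>{1..r}. mono_in n (u j)) \<and>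
     J = Idl\<^bsub>poly_ring n\<^esub> ((\<lambda>j. mono_poly (u j)) ` {1..r}) \<and>
     (\<forall>K. K \<subset> {1..r} \<longrightarrow> J \<noteq> Idl\<^bsub>poly_ring n\<^esub> ((\<lambda>j. mono_poly (u j)) ` K))"

section \<open>Multisets of monomials and their lcm graphs\<close>

text \<open>A multiset of \<open>q\<close> monomials is a family \<open>U\<close>, of which only the values on \<open>{1..q}\<close> matter.\<close>

definition lcm_at :: "(nat \<Rightarrow> monom) \<Rightarrow> nat set \<Rightarrow> monom" where
  "lcm_at U T = mono_lcm (U ` T)"

definition lcm_set :: "nat \<Rightarrow> (nat \<Rightarrow> monom) \<Rightarrow> monom set" where
  "lcm_set q U = lcm_at U ` Pow {1..q}"

definition lcm_fiber :: "nat \<Rightarrow> (nat \<Rightarrow> monom) \<Rightarrow> monom \<Rightarrow> nat set set" where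
  "lcm_fiber q U w = {T. T \<subseteq> {1..q} \<and> lcm_at U T = w}"

record ('v, 'l) labeled_digraph =
  digraph_of :: "'v pair_pre_digraph"
  label_of :: "'v \<Rightarrow> 'l"

definition lcm_graph :: "nat \<Rightarrow> (nat \<Rightarrow> monom) \<Rightarrow> (nat set, monom) labeled_digraph" where
  "lcm_graph q U =
     \<lparr>digraph_of =
        \<lparr>pverts = Pow {1..q},
         parcs = {(T, T'). T \<subseteq> {1..q} \<and> T' \<subseteq> T \<and> card T = card T' + 1}\<rparr>,
      label_of = lcm_at U\<rparr>"

definition induced_lcm_graph ::
    "nat \<Rightarrow> (nat \<Rightarrow> monom) \<Rightarrow> nat set set \<Rightarrow> (nat set, nat set \<times> nat set) pre_digraph" where
  "induced_lcm_graph q U W = with_proj (digraph_of (lcm_graph q U)) \<restriction> W"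

text \<open>
  A vertex map is an isomorphism of underlying undirected graphs if, together with the arc map it
  induces, it is a digraph isomorphism between the symmetrizations. Labels play no role.
\<close>

definition underlying_graph_iso ::
    "('a \<Rightarrow> 'b) \<Rightarrow> ('a, 'c) pre_digraph \<Rightarrow> ('b, 'd) pre_digraph \<Rightarrow> bool" where
  "underlying_graph_iso f G H \<longleftrightarrow>
     (let h = \<lparr>iso_verts = f, iso_arcs = map_prod f f, iso_head = snd, iso_tail = fst\<rparr> in
      pre_digraph.digraph_isomorphism (with_proj (mk_symmetric G)) h \<and>
      app_iso h (with_proj (mk_symmetric G)) = with_proj (mk_symmetric H))"

text \<open>
  The ordered generators \<open>u\<^sub>1, \<dots>, u\<^sub>r, x\<^sub>1\<^sup>e\<^sup>1, \<dots>, x\<^sub>n\<^sup>e\<^sup>n\<close>, with \<open>e j\<close> the exponent of the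
  \<open>j\<close>-th pure power.
\<close>

definition artinian_gens :: "nat \<Rightarrow> (nat \<Rightarrow> monom) \<Rightarrow> (nat \<Rightarrow> nat) \<Rightarrow> nat \<Rightarrow> monom" where
  "artinian_gens r u e j = (if j \<le> r then u j else Poly_Mapping.single (j - r) (e (j - r)))"

text \<open>
  Pitfall for a monomial \<open>w\<close> in the lcm set of these generators, with exponents \<open>b i\<close>: the index set
  \<open>A\<close> to which monomials are restricted has to be \<open>{i. b i < e i}\<close>, with \<open>b i = 0\<close> allowed.
  With \<open>{i. 0 < b i \<and> b i < e i}\<close> the restricted monomials no longer remember that a generator
  \<open>u j\<close> divisible by some \<open>x\<^sub>i\<close> with \<open>b i = 0\<close> cannot divide \<open>w\<close>. For example, if \<open>w = 1\<close> then every
  \<open>u j\<close> would restrict to 1, so that the fiber over the restriction of \<open>w\<close> would consist of all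
  subsets of \<open>{1..r}\<close>, whereas the fiber over \<open>w\<close> is \<open>{{}}\<close>. If all \<open>b i\<close> are positive, the two
  choices of \<open>A\<close> agree.
\<close>

section \<open>Set families\<close>

definition family_join :: "'a set set \<Rightarrow> 'a set set \<Rightarrow> 'a set set"  (infixl \<open>\<star>\<close> 65) where
  "X \<star> Y = {S \<union> T | S T. S \<in> X \<and> T \<in> Y}"

definition simplicial_complex :: "'a set \<Rightarrow> 'a set set \<Rightarrow> bool" where
  "simplicial_complex W D \<longleftrightarrow>
     D \<subseteq> Pow W \<and> (\<forall>w\<in>W. {w} \<in> D) \<and> (\<forall>F\<in>D. \<forall>F'. F' \<subseteq> F \<longrightarrow> F' \<in> D)"

section \<open>Basic checks\<close>

lemma lookup_mono_lcm:
  assumes "finite M"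
  shows "Poly_Mapping.lookup (mono_lcm M) i = Max (insert 0 ((\<lambda>m. Poly_Mapping.lookup m i) ` M))"
proof -
  have "{i. Max (insert 0 ((\<lambda>m. Poly_Mapping.lookup m i) ` M)) \<noteq> 0} \<subseteq> (\<Union>m\<in>M. Poly_Mapping.keys m)"
  proof
    fix i assume *: "i \<in> {i. Max (insert 0 ((\<lambda>m. Poly_Mapping.lookup m i) ` M)) \<noteq> 0}"
    have "Max (insert 0 ((\<lambda>m. Poly_Mapping.lookup m i) ` M)) \<in> insert 0 ((\<lambda>m. Poly_Mapping.lookup m i) ` M)"
      using assms by (intro Max_in) auto
    with * show "i \<in> (\<Union>m\<in>M. Poly_Mapping.keys m)" by (auto simp: in_keys_iff)
  qed
  then have "finite {i. Max (insert 0 ((\<lambda>m. Poly_Mapping.lookup m i) ` M)) \<noteq> 0}"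
    by (rule finite_subset) (use assms in auto)
  then show ?thesis by (simp add: mono_lcm_def Abs_poly_mapping_inverse)
qed

lemma mdvd_iff_lookup: "m mdvd m' \<longleftrightarrow> (\<forall>i. Poly_Mapping.lookup m i \<le> Poly_Mapping.lookup m' i)"
proof
  assume *: "\<forall>i. Poly_Mapping.lookup m i \<le> Poly_Mapping.lookup m' i"
  have "m' = m + (m' - m)"
    using * by (intro poly_mapping_eqI) (simp add: lookup_add lookup_minus)
  then show "m mdvd m'" unfolding mono_dvd_def by blast
qed (auto simp: mono_dvd_def lookup_add)

lemma mono_lcm_universal:
  assumes "finite M"
  shows "mono_lcm M mdvd k \<longleftrightarrow> (\<forall>m\<in>M. m mdvd k)"
  using assms by (auto simp: mdvd_iff_lookup lookup_mono_lcm)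

lemma mono_in_add: "mono_in n a \<Longrightarrow> mono_in n b \<Longrightarrow> mono_in n (a + b)"
  using keys_add[of a b] by (auto simp: mono_in_def)

lemma cring_poly_ring: "cring (poly_ring n :: ('k::field) mpoly ring)"
proof (rule cringI)
  show "abelian_group (poly_ring n :: 'k mpoly ring)"
  proof (rule abelian_groupI)
    fix p :: "'k mpoly" assume "p \<in> carrier (poly_ring n)"
    then show "\<exists>q\<in>carrier (poly_ring n). q \<oplus>\<^bsub>poly_ring n\<^esub> p = \<zero>\<^bsub>poly_ring n\<^esub>"
      by (intro bexI[of _ "- p"]) (auto simp: poly_ring_def)
  next
    fix p q :: "'k mpoly" assume "p \<in> carrier (poly_ring n)" "q \<in> carrier (poly_ring n)"
    then show "p \<oplus>\<^bsub>poly_ring n\<^esub> q \<in> carrier (poly_ring n)"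
      using keys_add[of p q] by (auto simp: poly_ring_def)
  qed (auto simp: poly_ring_def algebra_simps)
  show "comm_monoid (poly_ring n :: 'k mpoly ring)"
  proof (rule comm_monoidI)
    fix p q :: "'k mpoly" assume *: "p \<in> carrier (poly_ring n)" "q \<in> carrier (poly_ring n)"
    show "p \<otimes>\<^bsub>poly_ring n\<^esub> q \<in> carrier (poly_ring n)"
    proof -
      have "mono_in n m" if m: "m \<in> Poly_Mapping.keys (p * q)" for m
      proof -
        obtain a b where "m = a + b" "a \<in> Poly_Mapping.keys p" "b \<in> Poly_Mapping.keys q"
          using m keys_mult[of p q] by blast
        with * show ?thesis by (auto simp: poly_ring_def intro: mono_in_add)
      qed
      then show ?thesis by (simp add: poly_ring_def)
    qed
  qed (auto simp: poly_ring_def algebra_simps mono_in_def keys_one)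
qed (auto simp: poly_ring_def algebra_simps)

end

theory Submission
  imports Defs
begin

text \<open>
  Only the generator \<open>x\<^sub>i\<^sup>e\<^sup>i\<close> has exponent \<open>e i\<close> at \<open>x\<^sub>i\<close>, so it belongs to a subset with lcm \<open>w\<close>
  exactly when \<open>i \<in> B\<close>. These generators do not affect the exponents at the indices in \<open>A\<close>, where
  the lcm is the one of the restricted monomials \<open>u' j\<close>. This gives the decomposition of the fiber.
  The members of the fiber over \<open>w'\<close> avoid \<open>V\<close> and form an up-set in the subsets of \<open>{1..r} - V\<close>,
  so that their complements in \<open>{1..r} - V\<close> are the faces of a simplicial complex; complementation
  reverses the covering relation.
\<close>

section \<open>Exponents of least common multiples\<close>

lemma lookup_mono_restrict:
  assumes "finite A"
  shows "Poly_Mapping.lookup (mono_restrict A m) i = (if i \<in> A then Poly_Mapping.lookup m i else 0)"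
  using assms by (simp add: mono_restrict_def lookup_sum lookup_single when_def)

lemma lookup_lcm_at:
  assumes "finite T"
  shows "Poly_Mapping.lookup (lcm_at U T) i = Max (insert 0 ((\<lambda>j. Poly_Mapping.lookup (U j) i) ` T))"
  using assms by (simp add: lcm_at_def lookup_mono_lcm image_image)

lemma lookup_lcm_at_Un:
  assumes "finite S" "finite T"
  shows "Poly_Mapping.lookup (lcm_at U (S \<union> T)) i =
    max (Poly_Mapping.lookup (lcm_at U S) i) (Poly_Mapping.lookup (lcm_at U T) i)"
proof -
  let ?f = "\<lambda>j. Poly_Mapping.lookup (U j) i"
  \<comment> \<open>A \<open>0\<close> in each part keeps both maxima over nonempty sets, even when
    \<open>S\<close> or \<open>T\<close> is empty.\<close>
  have "insert 0 (?f ` (S \<union> T)) = insert 0 (?f ` S) \<union> insert 0 (?f ` T)"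
    by auto
  then show ?thesis
    using assms by (simp add: lookup_lcm_at Max_Un del: Un_insert_left Un_insert_right)
qed

lemma lookup_lcm_at_eqI:
  assumes "finite T" "\<And>j. j \<in> T \<Longrightarrow> Poly_Mapping.lookup (U j) i \<le> b"
    and "b = 0 \<or> (\<exists>j\<in>T. Poly_Mapping.lookup (U j) i = b)"
  shows "Poly_Mapping.lookup (lcm_at U T) i = b"
  using assms by (auto simp: lookup_lcm_at intro!: Max_eqI)

lemma lcm_at_cong: "(\<And>j. j \<in> T \<Longrightarrow> U j = U' j) \<Longrightarrow> lcm_at U T = lcm_at U' T"
  by (simp add: lcm_at_def cong: image_cong)

lemma mdvd_lcm_at:
  assumes "finite T" "j \<in> T"
  shows "U j mdvd lcm_at U T"
  using assms mono_lcm_universal[of "U ` T" "lcm_at U T"]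
  by (auto simp: lcm_at_def mdvd_iff_lookup)

text \<open>The universal property makes \<open>lcm_at U T\<close> divide \<open>lcm_at U S\<close>,
  and the inclusion gives the converse. This is the source of the up-closure of fibers.\<close>

lemma lcm_at_eq_mono:
  assumes "finite T" "S \<subseteq> T" "\<And>j. j \<in> T \<Longrightarrow> U j mdvd lcm_at U S"
  shows "lcm_at U T = lcm_at U S"
proof (rule poly_mapping_eqI)
  fix i
  have "finite S" using assms finite_subset by blast
  have "Poly_Mapping.lookup (lcm_at U T) i \<le> Poly_Mapping.lookup (lcm_at U S) i"
    using assms mono_lcm_universal[of "U ` T" "lcm_at U S"]
    by (auto simp: mdvd_iff_lookup lcm_at_def)
  moreover have "Poly_Mapping.lookup (lcm_at U S) i \<le> Poly_Mapping.lookup (lcm_at U T) i"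
    using lookup_lcm_at_Un[OF \<open>finite S\<close> \<open>finite T\<close>, of U i] \<open>S \<subseteq> T\<close> by (simp add: Un_absorb1)
  ultimately show "Poly_Mapping.lookup (lcm_at U T) i = Poly_Mapping.lookup (lcm_at U S) i"
    by simp
qed

text \<open>Restriction acts at each index in the same way on all monomials, keeping the exponent or
  replacing it by 0; both operations commute with maxima.\<close>

lemma lcm_at_mono_restrict:
  assumes "finite A" "finite T"
  shows "lcm_at (\<lambda>j. mono_restrict A (U j)) T = mono_restrict A (lcm_at U T)"
proof (rule poly_mapping_eqI)
  fix i
  have "Max (insert 0 ((\<lambda>j. 0 :: nat) ` T)) = 0"
    using assms by (intro Max_eqI) auto
  then show "Poly_Mapping.lookup (lcm_at (\<lambda>j. mono_restrict A (U j)) T) i =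
      Poly_Mapping.lookup (mono_restrict A (lcm_at U T)) i"
    using assms by (simp add: lookup_lcm_at lookup_mono_restrict)
qed

lemma subset_atLeastAtMost_add_split:
  fixes r n :: nat
  assumes "T \<subseteq> {1..r + n}"
  obtains S K where "S \<subseteq> {1..r}" "K \<subseteq> {1..n}" "T = S \<union> (+) r ` K"
proof
  show "T \<inter> {1..r} \<subseteq> {1..r}" "{i \<in> {1..n}. r + i \<in> T} \<subseteq> {1..n}" by auto
  show "T = T \<inter> {1..r} \<union> (+) r ` {i \<in> {1..n}. r + i \<in> T}"
  proof (intro equalityI subsetI)
    fix j assume "j \<in> T"
    show "j \<in> T \<inter> {1..r} \<union> (+) r ` {i \<in> {1..n}. r + i \<in> T}"
    proof (cases "j \<le> r")
      case True
      with \<open>j \<in> T\<close> assms show ?thesis by auto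
    next
      case False
      with \<open>j \<in> T\<close> assms have "j = r + (j - r)" "j - r \<in> {i \<in> {1..n}. r + i \<in> T}" by auto
      then show ?thesis by blast
    qed
  qed auto
qed

section \<open>Fibers of the lcm map\<close>

text \<open>A pure power contributes an exponent only at its own variable, where \<open>lt\<close>
  makes \<open>e i\<close> dominate every \<open>u j\<close>; at all other variables only
  \<open>S\<close> counts.\<close>

lemma lookup_lcm_at_artinian_gens:
  assumes lt: "\<forall>i\<in>{1..n}. \<forall>j\<in>{1..r}. Poly_Mapping.lookup (u j) i < e i"
    and "S \<subseteq> {1..r}" "K \<subseteq> {1..n}"
  shows "Poly_Mapping.lookup (lcm_at (artinian_gens r u e) (S \<union> (+) r ` K)) i =
    (if i \<in> K then e i else Poly_Mapping.lookup (lcm_at u S) i)"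
proof -
  have fin: "finite S" "finite K" using assms finite_subset by blast+
  have "lcm_at (artinian_gens r u e) S = lcm_at u S"
    by (rule lcm_at_cong) (use assms in \<open>auto simp: artinian_gens_def\<close>)
  moreover have "Poly_Mapping.lookup (lcm_at (artinian_gens r u e) ((+) r ` K)) i =
      (if i \<in> K then e i else 0)"
  proof (rule lookup_lcm_at_eqI)
    \<comment> \<open>Since \<open>k \<ge> 1\<close>, the index \<open>r + k\<close> exceeds
      \<open>r\<close> and selects the pure-power branch of \<open>artinian_gens\<close>.\<close>
    have gen: "Poly_Mapping.lookup (artinian_gens r u e (r + k)) i = (if k = i then e i else 0)"
      if "k \<in> K" for k
      using that \<open>K \<subseteq> {1..n}\<close> by (auto simp: artinian_gens_def lookup_single when_def)
    show "Poly_Mapping.lookup (artinian_gens r u e j) i \<le> (if i \<in> K then e i else 0)"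
      if "j \<in> (+) r ` K" for j
      using that gen by auto
    show "(if i \<in> K then e i else 0) = 0 \<or>
        (\<exists>j\<in>(+) r ` K. Poly_Mapping.lookup (artinian_gens r u e j) i = (if i \<in> K then e i else 0))"
      using gen by (cases "i \<in> K") auto
  qed (use fin in simp)
  moreover have "Poly_Mapping.lookup (lcm_at u S) i \<le> e i" if "i \<in> K"
  proof -
    have "Poly_Mapping.lookup (u j) i \<le> e i" if "j \<in> S" for j
      using that \<open>i \<in> K\<close> assms by (intro less_imp_le) blast
    with fin show ?thesis by (auto simp: lookup_lcm_at)
  qed
  ultimately show ?thesis using fin by (auto simp: lookup_lcm_at_Un)
qed

text \<open>The set of pure powers can be read off from \<open>w\<close>, so only the part inside
  \<open>{1..r}\<close> varies within the fiber. Indices with exponent 0 in \<open>w\<close> belong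
  to \<open>A\<close>, so the restricted lcm also records which variables must be absent.\<close>

lemma lcm_fiber_artinian_gens:
  assumes mono: "\<forall>j\<in>{1..r}. mono_in n (u j)"
    and lt: "\<forall>i\<in>{1..n}. \<forall>j\<in>{1..r}. Poly_Mapping.lookup (u j) i < e i"
    and pos: "\<forall>i\<in>{1..n}. 0 < e i"
    and w: "w \<in> lcm_set (r + n) (artinian_gens r u e)"
    and A: "A = {i \<in> {1..n}. Poly_Mapping.lookup w i < e i}"
    and B: "B = {i \<in> {1..n}. Poly_Mapping.lookup w i = e i}"
  shows "lcm_fiber (r + n) (artinian_gens r u e) w =
      lcm_fiber r (\<lambda>j. mono_restrict A (u j)) (mono_restrict A w) \<star> {(+) r ` B}" (is "?L = ?R")
    and "mono_restrict A w \<in> lcm_set r (\<lambda>j. mono_restrict A (u j))"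
proof -
  let ?g = "artinian_gens r u e"
  have finA: "finite A" by (simp add: A)
  note lookup = lookup_lcm_at_artinian_gens[OF lt]
  \<comment> \<open>\<open>pos\<close> handles the \<open>0\<close> inserted in the maximum, in
    particular for empty \<open>S\<close>.\<close>
  have small: "Poly_Mapping.lookup (lcm_at u S) i < e i" if "S \<subseteq> {1..r}" "i \<in> {1..n}" for S i
  proof -
    have "finite S" using that(1) finite_subset by blast
    moreover have "Poly_Mapping.lookup (u j) i < e i" if "j \<in> S" for j
      using that \<open>S \<subseteq> {1..r}\<close> \<open>i \<in> {1..n}\<close> lt by blast
    ultimately show ?thesis using pos that(2) by (simp add: lookup_lcm_at)
  qed
  have zero: "Poly_Mapping.lookup (lcm_at u S) i = 0" if "S \<subseteq> {1..r}" "i \<notin> {1..n}" for S i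
  proof (rule lookup_lcm_at_eqI)
    show "finite S" using that(1) finite_subset by blast
    show "Poly_Mapping.lookup (u j) i \<le> 0" if "j \<in> S" for j
    proof -
      have "Poly_Mapping.keys (u j) \<subseteq> {1..n}"
        using mono that \<open>S \<subseteq> {1..r}\<close> unfolding mono_in_def by blast
      with \<open>i \<notin> {1..n}\<close> have "i \<notin> Poly_Mapping.keys (u j)" by blast
      then show ?thesis by (simp add: in_keys_iff)
    qed
  qed auto
  have fwd: "K = B \<and> lcm_at (\<lambda>j. mono_restrict A (u j)) S = mono_restrict A w"
    if "S \<subseteq> {1..r}" "K \<subseteq> {1..n}" and eq: "lcm_at ?g (S \<union> (+) r ` K) = w" for S K
  proof -
    have l: "Poly_Mapping.lookup w i = (if i \<in> K then e i else Poly_Mapping.lookup (lcm_at u S) i)" for i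
      using lookup[OF that(1,2)] eq by simp
    \<comment> \<open>For \<open>i\<close> in \<open>{1..n}\<close> outside \<open>K\<close> the
      exponent comes from \<open>S\<close> alone and is below \<open>e i\<close> by
      \<open>small\<close>.\<close>
    have "i \<in> K \<longleftrightarrow> i \<in> B" for i
      using l[of i] small[OF that(1), of i] that(2) by (cases "i \<in> K") (auto simp: B)
    then have "K = B" by blast
    moreover have "mono_restrict A (lcm_at u S) = mono_restrict A w"
    proof (rule poly_mapping_eqI)
      fix i
      have "i \<notin> K" if "i \<in> A" using that l[of i] by (auto simp: A)
      then show "Poly_Mapping.lookup (mono_restrict A (lcm_at u S)) i =
          Poly_Mapping.lookup (mono_restrict A w) i"
        using l[of i] by (simp add: lookup_mono_restrict finA)
    qed
    ultimately show ?thesis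
      using that(1) finA finite_subset[OF that(1)] by (simp add: lcm_at_mono_restrict)
  qed
  \<comment> \<open>A reference decomposition of \<open>w\<close>: it determines the exponents of
    \<open>w\<close> on and off \<open>B\<close>, which the converse direction \<open>bwd\<close>
    compares with those of an arbitrary \<open>S\<close>.\<close>
  obtain S0 K0 where S0: "S0 \<subseteq> {1..r}" and K0: "K0 \<subseteq> {1..n}" and w0: "lcm_at ?g (S0 \<union> (+) r ` K0) = w"
  proof -
    from w obtain T where "T \<subseteq> {1..r + n}" and T: "w = lcm_at ?g T"
      by (auto simp: lcm_set_def)
    then obtain S K where "S \<subseteq> {1..r}" "K \<subseteq> {1..n}" "T = S \<union> (+) r ` K"
      by (elim subset_atLeastAtMost_add_split)
    with that T show thesis by blast
  qed
  have K0_eq: "K0 = B" using fwd[OF S0 K0 w0] by simp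
  have BK: "B \<subseteq> {1..n}" by (auto simp: B)
  have bwd: "lcm_at ?g (S \<union> (+) r ` B) = w"
    if S: "S \<subseteq> {1..r}" and eq: "lcm_at (\<lambda>j. mono_restrict A (u j)) S = mono_restrict A w" for S
  proof (rule poly_mapping_eqI)
    fix i
    have eq': "mono_restrict A (lcm_at u S) = mono_restrict A w"
      using eq finA finite_subset[OF S] by (simp add: lcm_at_mono_restrict)
    have w_i: "Poly_Mapping.lookup w i =
        (if i \<in> B then e i else Poly_Mapping.lookup (lcm_at u S0) i)" for i
      using lookup[OF S0 K0] w0 K0_eq by simp
    \<comment> \<open>\<open>A\<close> and \<open>B\<close> cover \<open>{1..n}\<close>, because no
      exponent of \<open>w\<close> exceeds \<open>e i\<close> there; outside \<open>{1..n}\<close>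
      both sides vanish by \<open>zero\<close>.\<close>
    consider "i \<in> B" | "i \<in> A" "i \<notin> B" | "i \<notin> {1..n}" "i \<notin> B"
      using small[OF S0, of i] w_i[of i] by (auto simp: A)
    then show "Poly_Mapping.lookup (lcm_at ?g (S \<union> (+) r ` B)) i = Poly_Mapping.lookup w i"
    proof cases
      case 2
      then show ?thesis
        using arg_cong[OF eq', of "\<lambda>m. Poly_Mapping.lookup m i"]
        by (simp add: lookup[OF S BK] lookup_mono_restrict finA)
    qed (simp_all add: lookup[OF S BK] w_i zero[OF S] zero[OF S0])
  qed
  show "mono_restrict A w \<in> lcm_set r (\<lambda>j. mono_restrict A (u j))"
    using fwd[OF S0 K0 w0] S0 unfolding lcm_set_def by (metis PowI imageI)
  show "?L = ?R"
  proof (intro equalityI subsetI)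
    fix T assume "T \<in> ?L"
    then have "T \<subseteq> {1..r + n}" and T: "lcm_at ?g T = w" by (auto simp: lcm_fiber_def)
    then obtain S K where "S \<subseteq> {1..r}" "K \<subseteq> {1..n}" "T = S \<union> (+) r ` K"
      by (elim subset_atLeastAtMost_add_split)
    with fwd[of S K] T show "T \<in> ?R" by (auto simp: family_join_def lcm_fiber_def)
  next
    fix T assume "T \<in> ?R"
    then obtain S where "S \<subseteq> {1..r}" "T = S \<union> (+) r ` B"
        "lcm_at (\<lambda>j. mono_restrict A (u j)) S = mono_restrict A w"
      by (auto simp: family_join_def lcm_fiber_def)
    with bwd[of S] BK show "T \<in> ?L" by (fastforce simp: lcm_fiber_def)
  qed
qed

section \<open>Fibers as up-sets and the complexes of their complements\<close>

lemma lcm_fiber_disjoint_nondivisors: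
  assumes "S \<in> lcm_fiber r U w"
  shows "S \<subseteq> {1..r} - {j \<in> {1..r}. \<not> U j mdvd w}"
  using assms mdvd_lcm_at[of S _ U] finite_subset[of S "{1..r}"] by (auto simp: lcm_fiber_def)

text \<open>Each added index belongs to a divisor of \<open>w\<close>, so the lcm does not
  grow.\<close>

lemma lcm_fiber_up_closed:
  assumes "S \<in> lcm_fiber r U w" "S \<subseteq> S'" "S' \<subseteq> {1..r} - {j \<in> {1..r}. \<not> U j mdvd w}"
  shows "S' \<in> lcm_fiber r U w"
proof -
  have "S' \<subseteq> {1..r}" using assms(3) by blast
  moreover have "lcm_at U S' = lcm_at U S"
    using assms finite_subset[OF \<open>S' \<subseteq> {1..r}\<close>]
    by (intro lcm_at_eq_mono) (auto simp: lcm_fiber_def)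
  ultimately show ?thesis using assms(1) by (simp add: lcm_fiber_def)
qed

text \<open>Complementation in \<open>P\<close> turns an up-set into a down-set. The vertex set is
  the union of the faces and not \<open>P\<close> itself, since an element of \<open>P\<close>
  common to all members of \<open>F\<close> lies in no face.\<close>

lemma simplicial_complex_complements:
  assumes "\<And>S. S \<in> F \<Longrightarrow> S \<subseteq> P"
    and "\<And>S S'. S \<in> F \<Longrightarrow> S \<subseteq> S' \<Longrightarrow> S' \<subseteq> P \<Longrightarrow> S' \<in> F"
  shows "simplicial_complex (\<Union>((-) P ` F)) ((-) P ` F)"
proof -
  have down: "G \<in> (-) P ` F" if "S \<in> F" "G \<subseteq> P - S" for S G
  proof -
    have "P - G \<in> F" using that assms(1)[OF that(1)] by (intro assms(2)[OF that(1)]) auto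
    moreover have "G = P - (P - G)" using that by blast
    ultimately show ?thesis by blast
  qed
  show ?thesis
    unfolding simplicial_complex_def
  proof (intro conjI ballI allI impI)
    fix v assume "v \<in> \<Union>((-) P ` F)"
    then obtain S where "S \<in> F" "{v} \<subseteq> P - S" by blast
    then show "{v} \<in> (-) P ` F" by (rule down)
  next
    fix D G assume "D \<in> (-) P ` F" "G \<subseteq> D"
    then show "G \<in> (-) P ` F" using down by blast
  qed blast
qed

section \<open>Antitone isomorphisms of lcm graphs\<close>

lemma verts_induced_lcm_graph: "verts (induced_lcm_graph q U W) = W"
  by (simp add: induced_lcm_graph_def)

lemma parcs_mk_symmetric_induced_lcm_graph:
  assumes "W \<subseteq> Pow {1..q}"
  shows "parcs (mk_symmetric (induced_lcm_graph q U W)) =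
    {(T, T'). T \<in> W \<and> T' \<in> W \<and>
      (T' \<subseteq> T \<and> card T = card T' + 1 \<or> T \<subseteq> T' \<and> card T' = card T + 1)}"
proof -
  have "arcs (induced_lcm_graph q U W) =
      {(T, T'). T \<in> W \<and> T' \<in> W \<and> T' \<subseteq> T \<and> card T = card T' + 1}"
    using assms by (auto simp: induced_lcm_graph_def lcm_graph_def)
  moreover have "tail (induced_lcm_graph q U W) = fst" "head (induced_lcm_graph q U W) = snd"
    by (simp_all add: induced_lcm_graph_def)
  ultimately show ?thesis by (simp only: parcs_mk_symmetric) auto
qed

text \<open>An order-reversing \<open>f\<close> reverses every arc, and the symmetrization contains
  both directions. The equivalence in \<open>cov\<close> ensures that arcs are reflected as well as
  preserved.\<close>

lemma underlying_graph_iso_antitone: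
  assumes W: "W \<subseteq> Pow {1..q}" "f ` W \<subseteq> Pow {1..q'}" and inj: "inj_on f W"
    and cov: "\<And>T T'. T \<in> W \<Longrightarrow> T' \<in> W \<Longrightarrow>
      f T \<subseteq> f T' \<and> card (f T') = card (f T) + 1 \<longleftrightarrow> T' \<subseteq> T \<and> card T = card T' + 1"
  shows "underlying_graph_iso f (induced_lcm_graph q U W) (induced_lcm_graph q' U' (f ` W))"
proof -
  let ?G = "mk_symmetric (induced_lcm_graph q U W)"
  let ?H = "mk_symmetric (induced_lcm_graph q' U' (f ` W))"
  note arcs = parcs_mk_symmetric_induced_lcm_graph[OF W(1), of U]
    parcs_mk_symmetric_induced_lcm_graph[OF W(2), of U']
  have "wf_digraph (with_proj ?G)"
    by unfold_locales (auto simp: arcs verts_induced_lcm_graph)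
  moreover have "inj_on (map_prod f f) (parcs ?G)"
    by (rule inj_on_subset[OF map_prod_inj_on[OF inj inj]]) (auto simp: arcs)
  moreover have "map_prod f f ` parcs ?G = parcs ?H"
  proof -
    \<comment> \<open>\<open>cov\<close>, applied to the pair in both orders, exchanges the two
      disjuncts that describe the arcs.\<close>
    have iff: "(f T, f T') \<in> parcs ?H \<longleftrightarrow> (T, T') \<in> parcs ?G" if "T \<in> W" "T' \<in> W" for T T'
      unfolding arcs mem_Collect_eq prod.case cov[OF that] cov[OF that(2,1)] using that by blast
    show ?thesis
    proof (intro equalityI subsetI)
      fix a assume "a \<in> map_prod f f ` parcs ?G"
      then obtain T T' where a: "a = (f T, f T')" "(T, T') \<in> parcs ?G" by auto
      then have "T \<in> W" "T' \<in> W" by (simp_all add: arcs)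
      with a iff show "a \<in> parcs ?H" by blast
    next
      fix a assume a: "a \<in> parcs ?H"
      then obtain T T' where T: "a = (f T, f T')" "T \<in> W" "T' \<in> W"
        unfolding arcs by blast
      with a iff have "(T, T') \<in> parcs ?G" by blast
      then show "a \<in> map_prod f f ` parcs ?G" by (rule rev_image_eqI) (simp add: T(1))
    qed
  qed
  ultimately show ?thesis
    using inj by (simp add: underlying_graph_iso_def pre_digraph.digraph_isomorphism_def
        app_iso_def with_proj_def verts_induced_lcm_graph)
qed

section \<open>The complement map on the fiber over \<open>w\<close>\<close>

theorem proposition4p3:
  fixes n r :: nat
    and u :: "nat \<Rightarrow> monom"
    and e :: "nat \<Rightarrow> nat"
    and J I :: "('k::field) mpoly set"
    and w w' :: monom
    and A B X' V :: "nat set"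
    and u' gens :: "nat \<Rightarrow> monom"
    and Iw :: "nat set set"
  assumes "minimally_generated_by n J r u"
    and "\<forall>i\<in>{1..n}. \<exists>j\<in>{1..r}. Poly_Mapping.single i 1 mdvd u j"
    and "\<forall>j\<in>{1..r}. \<not> (\<exists>i\<in>{1..n}. \<exists>k\<ge>1. u j = Poly_Mapping.single i k)"
    and "\<forall>i\<in>{1..n}. e i > Max ((\<lambda>j. Poly_Mapping.lookup (u j) i) ` {1..r})"
    and "gens = artinian_gens r u e"
    and "I = Idl\<^bsub>poly_ring n\<^esub> ((\<lambda>j. mono_poly (gens j)) ` {1..r + n})"
    and "w \<in> lcm_set (r + n) gens"
    and "A = {i\<in>{1..n}. Poly_Mapping.lookup w i < e i}"
    and "B = {i\<in>{1..n}. Poly_Mapping.lookup w i = e i}"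
    and "u' = (\<lambda>j. mono_restrict A (u j))"
    and "w' = mono_restrict A w"
    and "X' = {r + i | i. i \<in> B}"
    and "V = {j\<in>{1..r}. \<not> u' j mdvd w'}"
    and "Iw = lcm_fiber (r + n) gens w"
  shows "w' \<in> lcm_set r u' \<and>
    Iw = lcm_fiber r u' w' \<star> {X'} \<and>
    (\<exists>W \<Delta> \<phi>. finite W \<and> card W \<le> r \<and> simplicial_complex W \<Delta> \<and> \<Delta> \<subseteq> Pow {1..r} \<and>
      underlying_graph_iso \<phi> (induced_lcm_graph (r + n) gens Iw) (induced_lcm_graph r u' \<Delta>) \<and>
      (\<forall>T\<in>Iw. \<phi> T = ({1..r} - (T - X')) - V) \<and>
      (\<forall>T1\<in>Iw. \<forall>T2\<in>Iw. card T2 = card T1 + 1 \<longrightarrow> card (\<phi> T1) = card (\<phi> T2) + 1) \<and>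
      (\<forall>T1\<in>Iw. \<forall>T2\<in>Iw. T1 \<subseteq> T2 \<longrightarrow> \<phi> T2 \<subseteq> \<phi> T1))"
proof -
  have mono: "\<forall>j\<in>{1..r}. mono_in n (u j)"
    using assms(1) by (simp add: minimally_generated_by_def)
  have lt: "\<forall>i\<in>{1..n}. \<forall>j\<in>{1..r}. Poly_Mapping.lookup (u j) i < e i"
  proof (intro ballI)
    fix i j assume that: "i \<in> {1..n}" "j \<in> {1..r}"
    have "Poly_Mapping.lookup (u j) i \<le> Max ((\<lambda>j. Poly_Mapping.lookup (u j) i) ` {1..r})"
      using that by (intro Max_ge) auto
    with assms(4) that show "Poly_Mapping.lookup (u j) i < e i" by (meson le_less_trans)
  qed
  \<comment> \<open>Each variable divides some \<open>u j\<close>, so an index \<open>j\<close>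
    exists for which \<open>lt\<close> bounds a natural number strictly by
    \<open>e i\<close>.\<close>
  have pos: "\<forall>i\<in>{1..n}. 0 < e i"
    using assms(2) lt by (metis gr_zeroI not_less_zero)
  have X': "X' = (+) r ` B" using assms(12) by auto
  let ?F = "lcm_fiber r u' w'"
  define P where "P = {1..r} - V"
  define \<phi> where "\<phi> T = ({1..r} - (T - X')) - V" for T
  have w': "w' \<in> lcm_set r u'" and Iw: "Iw = ?F \<star> {X'}"
    using lcm_fiber_artinian_gens[OF mono lt pos, of w A B] assms(5,7-11,14) X' by simp_all
  have F_P: "S \<subseteq> P" if "S \<in> ?F" for S
    using lcm_fiber_disjoint_nondivisors[OF that] assms(13) by (simp add: P_def)
  have up: "S' \<in> ?F" if "S \<in> ?F" "S \<subseteq> S'" "S' \<subseteq> P" for S S'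
    using lcm_fiber_up_closed[OF that(1,2)] that(3) assms(13) by (simp add: P_def)
  have finP: "finite P" and finX: "finite X'"
    using X' assms(9) by (auto simp: P_def)
  \<comment> \<open>Elements of \<open>B\<close> are at least 1, so those of \<open>X'\<close>
    exceed \<open>r\<close>.\<close>
  have disj: "P \<inter> X' = {}" using X' assms(9) by (auto simp: P_def)
  \<comment> \<open>On the fiber, \<open>\<phi>\<close> is complementation in \<open>P\<close> after
    removal of the fixed part \<open>X'\<close>. The cardinalities are stated as sums to avoid
    truncated subtraction.\<close>
  have Iw_cases: "\<exists>S\<in>?F. S \<subseteq> P \<and> T = S \<union> X' \<and> T - X' = S \<and> \<phi> T = P - S \<and>
      card T = card S + card X' \<and> card (\<phi> T) + card S = card P" if "T \<in> Iw" for T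
  proof -
    from that obtain S where S: "S \<in> ?F" "T = S \<union> X'" by (auto simp: Iw family_join_def)
    have SP: "S \<subseteq> P" using F_P S(1) .
    then have "T - X' = S" using S(2) disj by blast
    moreover have "card T = card S + card X'"
      unfolding S(2) using SP disj finP finX by (intro card_Un_disjoint) (auto intro: finite_subset)
    moreover have "\<phi> T = P - S"
      using \<open>T - X' = S\<close> by (auto simp: \<phi>_def P_def)
    moreover have "card (P - S) + card S = card P"
      using SP finP by (simp add: card_Diff_subset card_mono finite_subset)
    ultimately show ?thesis using S SP by auto
  qed
  have image: "\<phi> ` Iw = (-) P ` ?F"
  proof (intro equalityI subsetI)
    fix D assume "D \<in> (-) P ` ?F"
    then obtain S where S: "S \<in> ?F" "D = P - S" by blast
    then have "S \<union> X' \<in> Iw" by (auto simp: Iw family_join_def)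
    moreover have "\<phi> (S \<union> X') = D"
      using S F_P[OF S(1)] disj by (auto simp: \<phi>_def P_def)
    ultimately show "D \<in> \<phi> ` Iw" by blast
  qed (use Iw_cases in blast)
  let ?W = "\<Union>(\<phi> ` Iw)"
  have W_P: "?W \<subseteq> P" by (auto simp: image)
  have "card ?W \<le> card {1..r}"
    using W_P by (intro card_mono) (auto simp: P_def)
  then have card_W: "card ?W \<le> r" by simp
  have finW: "finite ?W" using W_P finP finite_subset by blast
  have complex: "simplicial_complex ?W (\<phi> ` Iw)"
    unfolding image by (rule simplicial_complex_complements) (use F_P up in blast)+
  have \<phi>_sub: "\<phi> ` Iw \<subseteq> Pow {1..r}" by (auto simp: \<phi>_def)
  \<comment> \<open>The common part \<open>X'\<close> cancels, and complementation within
    \<open>P\<close> both reverses and reflects inclusion; injectivity of \<open>\<phi>\<close>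
    follows by antisymmetry.\<close>
  have anti: "\<phi> T \<subseteq> \<phi> T' \<longleftrightarrow> T' \<subseteq> T" if "T \<in> Iw" "T' \<in> Iw" for T T'
    using Iw_cases[OF that(1)] Iw_cases[OF that(2)] disj by (elim bexE conjE) blast
  \<comment> \<open>\<open>card X'\<close> and \<open>card P\<close> are the same for all vertices,
    so both sides compare only the parts \<open>S\<close> of \<open>T\<close> and
    \<open>T'\<close>.\<close>
  have card: "card (\<phi> T') = card (\<phi> T) + 1 \<longleftrightarrow> card T = card T' + 1" if "T \<in> Iw" "T' \<in> Iw" for T T'
    using Iw_cases[OF that(1)] Iw_cases[OF that(2)] by (elim bexE conjE) linarith
  have "underlying_graph_iso \<phi> (induced_lcm_graph (r + n) gens Iw)
      (induced_lcm_graph r u' (\<phi> ` Iw))"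
  proof (rule underlying_graph_iso_antitone)
    show "Iw \<subseteq> Pow {1..r + n}" using assms(14) by (auto simp: lcm_fiber_def)
    show "inj_on \<phi> Iw" using anti by (intro inj_onI) (metis order_antisym order_refl)
  qed (use \<phi>_sub anti card in auto)
  with w' Iw finW card_W complex \<phi>_sub anti card show ?thesis
    by (intro conjI exI[of _ ?W] exI[of _ "\<phi> ` Iw"] exI[of _ \<phi>]) (simp_all add: \<phi>_def)
qed

end
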